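(* Let $q=2^s$ with $s>1$, $e>0$, $a\ge 0$ integers, and $n=(q-1)q^0+(q-1)q^e+2q^a$. Then $g_{n,q}\equiv x\,\mathrm{Tr}_{q^e/q}(x)+\mathrm{Tr}_{q^e/q}(x)^2+S_a^2\cdot\big(1+\mathrm{Tr}_{q^e/q}(x)^{q-1}\big)\pmod{x^{q^e}-x}$. If moreover $e$ is even and $\gcd(a,e)=1$, then $g_{n,q}$ is a permutation polynomial of $\mathbb{F}_{q^e}$.
   Context: For a prime $p$, a power $q$ of $p$ and an integer $n\ge 0$, $g_{n,q}\in\mathbb{F}_p[x]$ is the unique polynomial with $\sum_{a\in\mathbb{F}_q}(x+a)^n=g_{n,q}(x^q-x)$. A permutation polynomial of a finite field $\mathbb{F}$ is a polynomial inducing a bijection of $\mathbb{F}$. For an integer $a\ge 0$, $S_a=x+x^q+\cdots+x^{q^{a-1}}$ ($S_0=0$), and $\mathrm{Tr}_{q^e/q}(x)=S_e=x+x^q+\cdots+x^{q^{e-1}}$, regarded as a polynomial. *)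

theory Defs
  imports
    "HOL-Number_Theory.Cong"
    "HOL-Computational_Algebra.Polynomial"
    "Berlekamp_Zassenhaus.Finite_Field"
begin

text \<open>
  For a field \<open>'f\<close> of prime characteristic \<open>p\<close>, we have \<open>CARD('f ring_char) = p\<close>, so
  \<open>'f ring_char mod_ring\<close> is the field with \<open>p\<close> elements.

  The following map is the inclusion of the field with \<open>p = CARD('p)\<close> elements into a field
  \<open>'a\<close> of the same characteristic; it is a ring homomorphism only if \<open>CHAR('a) = CARD('p)\<close>.
\<close>

definition of_prime_field :: "'p::prime_card mod_ring \<Rightarrow> 'a::field" where
  "of_prime_field c = of_int (to_int_mod_ring c)"

definition lift_poly :: "'p::prime_card mod_ring poly \<Rightarrow> 'a::field poly" where
  "lift_poly f = map_poly of_prime_field f"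

text \<open>
  The polynomial \<open>g\<^bsub>n,q\<^esub>\<close>, where \<open>'f\<close> is the field with \<open>q\<close> elements. It has coefficients in the
  prime field, while its defining identity lives in \<open>'f poly\<close>.
\<close>

definition g_poly :: "'f::finite_field itself \<Rightarrow> nat \<Rightarrow> 'f ring_char mod_ring poly" where
  "g_poly _ n = (THE g.
     (\<Sum>a\<in>(UNIV :: 'f set). (monom 1 1 + [:a:]) ^ n) =
       lift_poly g \<circ>\<^sub>p (monom 1 CARD('f) - monom 1 1))"

definition S_poly :: "nat \<Rightarrow> nat \<Rightarrow> 'a::comm_ring_1 poly" where
  "S_poly q a = (\<Sum>i<a. monom 1 (q ^ i))"

abbreviation (input) Tr_poly :: "nat \<Rightarrow> nat \<Rightarrow> 'a::comm_ring_1 poly" where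
  "Tr_poly q e \<equiv> S_poly q e"

definition permutation_poly :: "'k::finite_field poly \<Rightarrow> bool" where
  "permutation_poly f \<longleftrightarrow> bij (poly f)"

end

theory Submission
  imports Defs
begin

text \<open>
  Put \<open>t = x\<^sup>q - x\<close> and \<open>u = x + a\<close> for \<open>a\<close> in the field with \<open>q\<close> elements. Iterating
  \<open>u\<^sup>q = u + t\<close> shows that \<open>u\<close> raised to \<open>q\<^sup>i\<close> is \<open>u + S\<^sub>i(t)\<close>, so that \<open>u\<^sup>n\<close> equals
  \<open>u\<^bsup>q-1\<^esup> (u + T)\<^bsup>q-1\<^esup> (u + S)\<^sup>2\<close> with \<open>T = S\<^sub>e(t)\<close> and \<open>S = S\<^sub>a(t)\<close>. In characteristic 2 all
  binomial coefficients of \<open>(u + T)\<^bsup>q-1\<^esup>\<close> are 1, and the power sums \<open>p\<^sub>k = \<Sum>\<^sub>a u\<^sup>k\<close> that occur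
  after expansion follow from \<open>p\<^sub>k = 0\<close> for \<open>k < q - 1\<close>, \<open>p\<^bsub>q-1\<^esub> = -1\<close> and
  \<open>p\<^bsub>q+m\<^esub> = p\<^bsub>m+1\<^esub> + t p\<^sub>m\<close>. The congruence thus even holds as an equality of polynomials.

  For the permutation property, \<open>Tr (g x) = (Tr x)\<^sup>2\<close> because \<open>e\<close> is even, so \<open>g x\<close> determines
  \<open>Tr x\<close>. If \<open>Tr x \<noteq> 0\<close> then \<open>g x = x Tr x + (Tr x)\<^sup>2\<close> determines \<open>x\<close>; on the kernel of the
  trace \<open>g x = (S\<^sub>a x)\<^sup>2\<close>, and \<open>S\<^sub>a\<close> and \<open>S\<^sub>e = Tr\<close> have no common nonzero root as
  \<open>gcd a e = 1\<close>.
\<close>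

section \<open>Power sums over a finite field\<close>

text \<open>Multiplication by a nonzero \<open>c\<close> permutes the field, so the sum is unchanged
  when multiplied by \<open>c ^ j\<close>. For \<open>j > 0\<close> some such \<open>c\<close> has
  \<open>c ^ j\<close> different from 1, since \<open>x ^ j - 1\<close> has at most \<open>j\<close>
  roots. For \<open>j = 0\<close> the sum is the cardinality, which is 0 in the field.\<close>

lemma sum_power_finite_field_eq_0:
  assumes "j < CARD('f::finite_field) - 1"
  shows "(\<Sum>a\<in>UNIV. a ^ j) = (0 :: 'f)"
proof (cases "j = 0")
  case True
  have "of_nat CARD('f) = (0 :: 'f)"
    using CHAR_dvd_CARD of_nat_eq_0_iff_char_dvd by blast
  then show ?thesis
    using True by simp
next
  case False
  obtain c :: 'f where c: "c \<noteq> 0" "c ^ j \<noteq> 1"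
  proof (rule ccontr)
    assume "\<not> thesis"
    then have all: "c ^ j = 1" if "c \<noteq> 0" for c :: 'f
      using that \<open>\<And>c. c \<noteq> 0 \<Longrightarrow> c ^ j \<noteq> 1 \<Longrightarrow> thesis\<close> by blast
    define P :: "'f poly" where "P = monom 1 j - 1"
    have "coeff P j = 1"
      using False by (simp add: P_def)
    then have "P \<noteq> 0"
      by auto
    have "degree P \<le> j"
      unfolding P_def by (intro degree_diff_le) (auto simp: degree_monom_le)
    have "CARD('f) - 1 = card (UNIV - {0 :: 'f})"
      by (simp add: card_Diff_singleton)
    also have "\<dots> \<le> card {x. poly P x = 0}"
      by (intro card_mono poly_roots_finite \<open>P \<noteq> 0\<close>) (auto simp: P_def poly_monom all)
    also have "\<dots> \<le> j"
      using card_poly_roots_bound[OF \<open>P \<noteq> 0\<close>] \<open>degree P \<le> j\<close> by simp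
    finally show False
      using assms by simp
  qed
  have "(\<Sum>a\<in>UNIV. a ^ j) = (\<Sum>a\<in>UNIV. (c * a) ^ j)"
    by (rule sum.reindex_bij_witness[of _ "\<lambda>a. c * a" "\<lambda>a. a / c"]) (use c in auto)
  also have "\<dots> = c ^ j * (\<Sum>a\<in>UNIV. a ^ j)"
    by (simp add: power_mult_distrib sum_distrib_left)
  finally show ?thesis
    using c by simp
qed

lemma power_card_minus_1:
  assumes "x \<noteq> (0 :: 'f::finite_field)"
  shows "x ^ (CARD('f) - 1) = 1"
proof -
  have "x ^ Suc (CARD('f) - 1) = x"
    using finite_field_power_card_eq_same[of x] finite_UNIV_card_ge_0[where ?'a = 'f]
    by (simp del: power_Suc)
  then show ?thesis
    using assms by (simp only: power_Suc) simp
qed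

lemma sum_power_card_minus_1: "(\<Sum>a\<in>UNIV. a ^ (CARD('f) - 1)) = (-1 :: 'f::finite_field)"
proof -
  have "CARD('f) > 1"
    using card_mono[of UNIV "{0, 1 :: 'f}"] by simp
  then have "(\<Sum>a\<in>UNIV. a ^ (CARD('f) - 1)) = (\<Sum>a\<in>UNIV - {0 :: 'f}. a ^ (CARD('f) - 1))"
    by (intro sum.mono_neutral_right) auto
  also have "\<dots> = (\<Sum>a\<in>UNIV - {0 :: 'f}. 1)"
    by (intro sum.cong refl power_card_minus_1) auto
  also have "\<dots> = of_nat (CARD('f) - 1)"
    by (simp add: card_Diff_singleton)
  also have "\<dots> = of_nat CARD('f) - 1"
    using \<open>CARD('f) > 1\<close> by (subst of_nat_diff) auto
  also have "of_nat CARD('f) = (0 :: 'f)"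
    using CHAR_dvd_CARD of_nat_eq_0_iff_char_dvd by blast
  finally show ?thesis
    by simp
qed

section \<open>Power sums of the shifts x + a and their recursion\<close>

definition shifted_power_sum :: "'f::finite_field itself \<Rightarrow> nat \<Rightarrow> 'f poly" where
  "shifted_power_sum _ k = (\<Sum>a\<in>UNIV. (monom 1 1 + [:a:]) ^ k)"

abbreviation Frob_diff :: "'f::finite_field poly" where
  "Frob_diff \<equiv> monom 1 CARD('f) - monom 1 1"

lemma shifted_power_sum_binomial:
  "shifted_power_sum TYPE('f::finite_field) k =
     (\<Sum>j\<le>k. of_nat (k choose j) * monom 1 (k - j) * [:\<Sum>a\<in>(UNIV :: 'f set). a ^ j:])"
proof -
  have "(monom 1 1 + [:a:]) ^ k = (\<Sum>j\<le>k. of_nat (k choose j) * monom 1 (k - j) * [:a ^ j:])" for a :: 'f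
    by (subst add.commute, subst binomial_ring)
      (simp add: monom_power poly_const_pow mult_ac)
  then have "shifted_power_sum TYPE('f) k =
      (\<Sum>a\<in>(UNIV :: 'f set). \<Sum>j\<le>k. of_nat (k choose j) * monom 1 (k - j) * [:a ^ j:])"
    by (simp add: shifted_power_sum_def)
  also have "\<dots> = (\<Sum>j\<le>k. of_nat (k choose j) * monom 1 (k - j) * (\<Sum>a\<in>(UNIV :: 'f set). [:a ^ j:]))"
    by (subst sum.swap) (simp add: sum_distrib_left)
  finally show ?thesis
    by (simp add: monom_sum flip: monom_0)
qed

lemma shifted_power_sum_eq_0:
  assumes "k < CARD('f::finite_field) - 1"
  shows "shifted_power_sum TYPE('f) k = 0"
  unfolding shifted_power_sum_binomial
  by (rule sum.neutral) (use assms in \<open>auto simp: sum_power_finite_field_eq_0\<close>)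

lemma shifted_power_sum_card_minus_1:
  "shifted_power_sum TYPE('f::finite_field) (CARD('f) - 1) = -1"
proof -
  let ?k = "CARD('f) - 1"
  have "shifted_power_sum TYPE('f) ?k =
      (\<Sum>j\<in>{?k}. of_nat (?k choose j) * monom 1 (?k - j) * [:\<Sum>a\<in>(UNIV :: 'f set). a ^ j:])"
    unfolding shifted_power_sum_binomial
    by (rule sum.mono_neutral_right) (auto simp: sum_power_finite_field_eq_0)
  also have "\<dots> = [:-1:]"
    using sum_power_card_minus_1[where ?'f = 'f] by (simp add: monom_0)
  finally show ?thesis
    by (simp add: one_pCons)
qed

lemma CHAR_finite_field_eqI:
  assumes "prime p" "CARD('f::finite_field) = p ^ m"
  shows "CHAR('f) = p"
proof -
  have "prime CHAR('f)"
    by simp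
  moreover have "CHAR('f) dvd p ^ m"
    using CHAR_dvd_CARD[where ?'a = 'f] assms by simp
  ultimately show ?thesis
    using assms(1) prime_dvd_power primes_dvd_imp_eq by blast
qed

lemma shifted_linear_power_card:
  assumes "CARD('f::finite_field) = CHAR('f) ^ s"
  shows "(monom 1 1 + [:a:]) ^ CARD('f) = monom 1 1 + [:a:] + (Frob_diff :: 'f poly)"
proof -
  have "(monom 1 1 + [:a:]) ^ CARD('f) = monom 1 1 ^ CARD('f) + [:a:] ^ CARD('f)"
    by (rule freshmans_dream'[of _ s]) (use assms in auto)
  then show ?thesis
    by (simp add: monom_power poly_const_pow finite_field_power_card_eq_same)
qed

text \<open>Multiply \<open>u^q = u + t\<close> by \<open>u^m\<close> and sum over all shifts
  \<open>u\<close>. Together with the values below \<open>q\<close> this determines every power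
  sum.\<close>

lemma shifted_power_sum_add_card:
  assumes "CARD('f::finite_field) = CHAR('f) ^ s"
  shows "shifted_power_sum TYPE('f) (CARD('f) + m) =
    shifted_power_sum TYPE('f) (m + 1) + Frob_diff * shifted_power_sum TYPE('f) m"
proof -
  have "(monom 1 1 + [:a:]) ^ (CARD('f) + m)
      = (monom 1 1 + [:a:]) ^ (m + 1) + Frob_diff * (monom 1 1 + [:a:]) ^ m" for a :: 'f
    by (simp only: power_add shifted_linear_power_card[OF assms] power_one_right distrib_right
        mult.commute[of "_ ^ m" "monom 1 1 + [:a:]"])
  then show ?thesis
    by (simp add: shifted_power_sum_def sum.distrib sum_distrib_left)
qed

section \<open>The linearized polynomials \<open>S\<^sub>a\<close>\<close>

lemma pcompose_monom: "pcompose (monom 1 k) p = p ^ k"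
  for p :: "'a::comm_ring_1 poly"
  by (induction k) (simp_all add: monom_0 monom_Suc pcompose_pCons)

lemma pcompose_power: "pcompose (p ^ k) r = pcompose p r ^ k"
  for p :: "'a::comm_ring_1 poly"
  by (induction k) (simp_all add: pcompose_mult pcompose_1)

lemma shifted_linear_power_card_power:
  fixes a :: "'f::finite_field"
  assumes "CARD('f) = CHAR('f) ^ s"
  shows "(monom 1 1 + [:a:]) ^ (CARD('f) ^ i) = monom 1 1 + [:a:] + S_poly CARD('f) i \<circ>\<^sub>p Frob_diff"
proof (induction i)
  case 0
  then show ?case by (simp add: S_poly_def)
next
  case (Suc i)
  \<comment> \<open>The inner q-th power is taken first, so that Frobenius then acts on
    \<open>u + t\<close>; its value \<open>t^(q^i)\<close> is the new summand of
    \<open>S_(i+1)(t)\<close>.\<close>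
  have "(monom 1 1 + [:a:]) ^ (CARD('f) ^ Suc i)
      = (monom 1 1 + [:a:] + Frob_diff) ^ (CARD('f) ^ i)"
    by (simp only: power_Suc power_mult shifted_linear_power_card[OF assms])
  also have "\<dots> = (monom 1 1 + [:a:]) ^ (CARD('f) ^ i) + Frob_diff ^ (CARD('f) ^ i)"
    by (rule freshmans_dream'[of _ "s * i"]) (use assms in \<open>auto simp: power_mult\<close>)
  finally show ?case
    by (simp only: Suc.IH S_poly_def sum.lessThan_Suc pcompose_add pcompose_monom add_ac)
qed

section \<open>Evaluation of the sum over all shifts\<close>

lemma geometric_sum_prime_power:
  fixes x y :: "'a::idom_prime_char"
  assumes "s > 0"
  shows "(x - y) ^ (CHAR('a) ^ s - 1) = (\<Sum>i<CHAR('a) ^ s. y ^ (CHAR('a) ^ s - Suc i) * x ^ i)"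
proof (cases "x = y")
  case True
  let ?q = "CHAR('a) ^ s"
  have "?q > 1"
    by (intro one_less_power prime_gt_1_nat assms) simp
  \<comment> \<open>Cancelling \<open>x - y\<close> is impossible here, but the sum consists of q
    equal terms and q is 0 in the ring.\<close>
  have "(\<Sum>i<?q. y ^ (?q - Suc i) * x ^ i) = (\<Sum>i<?q. y ^ (?q - 1))"
    using True by (intro sum.cong) (auto simp flip: power_add)
  also have "\<dots> = 0"
    using assms by simp
  finally show ?thesis
    using True \<open>?q > 1\<close> by simp
next
  case False
  let ?q = "CHAR('a) ^ s"
  \<comment> \<open>Frobenius turns \<open>(x - y)^q\<close> into \<open>x^q - y^q\<close>; one
    factor \<open>x - y\<close> is then cancelled against the usual factorization.\<close>
  have "((x - y) + y) ^ ?q = (x - y) ^ ?q + y ^ ?q"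
    by (rule freshmans_dream') auto
  then have "(x - y) ^ Suc (?q - 1) = x ^ ?q - y ^ ?q"
    by (simp add: algebra_simps)
  also have "\<dots> = (x - y) * (\<Sum>i<?q. y ^ (?q - Suc i) * x ^ i)"
    by (rule power_diff_sumr2)
  finally have "(x - y) * (x - y) ^ (?q - 1) = (x - y) * (\<Sum>i<?q. y ^ (?q - Suc i) * x ^ i)"
    by (simp only: power_Suc)
  then show ?thesis
    using False by (simp only: mult_cancel_left right_minus_eq simp_thms)
qed

lemma sum_shifted_products:
  fixes T S :: "'f::finite_field poly"
  assumes s: "s > 1" and q: "q = 2 ^ s" "CARD('f) = q"
  defines "u \<equiv> \<lambda>a :: 'f. monom 1 1 + [:a:]"
  shows "(\<Sum>a\<in>UNIV. u a ^ (q - 1) * (u a + T) ^ (q - 1) * (u a + S) ^ 2)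
    = Frob_diff * T + T ^ 2 + S ^ 2 * (1 + T ^ (q - 1))"
proof -
  let ?p = "shifted_power_sum TYPE('f)"
  have char: "CHAR('f) = 2"
    by (rule CHAR_finite_field_eqI[of _ s]) (use q in auto)
  have two: "(2 :: 'f poly) = 0"
    using of_nat_CHAR[where ?'a = "'f poly"] char by simp
  have minus: "- x = x" for x :: "'f poly"
    using two by (metis add_eq_0_iff mult_2 mult_zero_left)
  have card: "CARD('f) = CHAR('f) ^ s"
    using q char by simp
  \<comment> \<open>\<open>s > 1\<close> gives \<open>q >= 4\<close>. Hence \<open>p_(q+1)\<close>
    falls under \<open>p_mid\<close>, which makes \<open>p_(2q)\<close> vanish.\<close>
  have "q \<ge> 2 ^ 2"
    unfolding q using s by (intro power_increasing) auto
  then have "q = Suc (Suc (Suc (q - 3)))" "q - 3 \<ge> 1"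
    by simp_all
  then obtain r where r: "q = Suc (Suc (Suc r))" "r \<ge> 1"
    by blast
  have p_low: "?p k = 0" if "k < q - 1" for k
    using that q by (simp add: shifted_power_sum_eq_0)
  have p_one: "?p (q - 1) = 1"
    using shifted_power_sum_card_minus_1[where ?'f = 'f] q minus[of 1] by simp
  have p_step: "?p (q + m) = ?p (m + 1) + Frob_diff * ?p m" for m
    using shifted_power_sum_add_card[OF card, of m] q by simp
  have p_mid: "?p (q + m) = 0" if "m < q - 2" for m
    using that by (simp add: p_step p_low)
  have p_a: "?p (q + (q - 2)) = 1"
    using r p_step[of "q - 2"] p_low[of "q - 2"] p_one by simp
  have p_b: "?p (q + (q - 1)) = Frob_diff"
    using r p_step[of "q - 1"] p_mid[of 0] p_one by simp
  have p_c: "?p (q + q) = 0"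
    using r p_step[of q] p_mid[of 0] p_mid[of 1] by simp
  have geom: "(x + T) ^ (q - 1) = (\<Sum>i<q. T ^ (q - Suc i) * x ^ i)" for x :: "'f poly"
  proof -
    have "x + T = x - T"
      by (simp only: diff_conv_add_uminus minus)
    then show ?thesis
      unfolding \<open>x + T = x - T\<close> using geometric_sum_prime_power[of s x T] s q char by simp
  qed
  have sq: "(x + S) ^ 2 = x ^ 2 + S ^ 2" for x :: "'f poly"
    by (simp add: power2_sum two)
  have expand: "x ^ (q - 1) * (x + T) ^ (q - 1) * (x + S) ^ 2
      = (\<Sum>i<q. T ^ (q - Suc i) * (x ^ (q + 1 + i) + S ^ 2 * x ^ (q - 1 + i)))" for x :: "'f poly"
  proof -
    have "x ^ (q - 1) * x ^ i * (x ^ 2 + S ^ 2) = x ^ (q + 1 + i) + S ^ 2 * x ^ (q - 1 + i)" for i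
      using r by (simp add: power_add power2_eq_square algebra_simps)
    then show ?thesis
      unfolding geom sq
      by (simp add: sum_distrib_left sum_distrib_right mult.assoc mult.left_commute)
  qed
  have "(\<Sum>a\<in>UNIV. u a ^ (q - 1) * (u a + T) ^ (q - 1) * (u a + S) ^ 2)
      = (\<Sum>i<q. \<Sum>a\<in>UNIV. T ^ (q - Suc i) * (u a ^ (q + 1 + i) + S ^ 2 * u a ^ (q - 1 + i)))"
    unfolding expand by (rule sum.swap)
  also have "\<dots> = (\<Sum>i<q. T ^ (q - Suc i) * (?p (q + 1 + i) + S ^ 2 * ?p (q - 1 + i)))"
    unfolding shifted_power_sum_def u_def
    by (simp only: sum.distrib flip: sum_distrib_left)
  also have "\<dots> = (\<Sum>i<q. T ^ (q - Suc i) * ?p (q + (i + 1)))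
      + S ^ 2 * (\<Sum>i<q. T ^ (q - Suc i) * ?p (q - 1 + i))"
    by (simp add: distrib_left sum.distrib sum_distrib_left mult_ac)
  also have "(\<Sum>i<q. T ^ (q - Suc i) * ?p (q + (i + 1))) = T ^ 2 + Frob_diff * T"
  proof -
    \<comment> \<open>The indices run from \<open>q + 1\<close> to \<open>2q\<close>, and
      \<open>p_mid\<close> kills all but the last three, whose weights are \<open>T^2\<close>,
      \<open>T\<close> and 1.\<close>
    have "(\<Sum>i<q. T ^ (q - Suc i) * ?p (q + (i + 1)))
        = (\<Sum>i<r. T ^ (q - Suc i) * ?p (q + (i + 1)))
          + T ^ 2 * ?p (q + (q - 2)) + T * ?p (q + (q - 1)) + ?p (q + q)"
      using r(1) by (simp add: numeral_2_eq_2)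
    also have "(\<Sum>i<r. T ^ (q - Suc i) * ?p (q + (i + 1))) = 0"
    proof (intro sum.neutral ballI)
      fix i
      assume "i \<in> {..<r}"
      then have "?p (q + (i + 1)) = 0"
        using r by (intro p_mid) simp
      then show "T ^ (q - Suc i) * ?p (q + (i + 1)) = 0"
        by (simp only: mult_zero_right)
    qed
    finally show ?thesis
      unfolding p_a p_b p_c by (simp add: mult.commute)
  qed
  also have "(\<Sum>i<q. T ^ (q - Suc i) * ?p (q - 1 + i)) = T ^ (q - 1) + 1"
  proof -
    \<comment> \<open>The indices run from \<open>q - 1\<close> to \<open>2q - 2\<close>, and only
      the two end terms survive.\<close>
    have "(\<Sum>i<q. T ^ (q - Suc i) * ?p (q - 1 + i))
        = (\<Sum>i<Suc (q - 1). T ^ (q - Suc i) * ?p (q - 1 + i))"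
      using r by simp
    also have "\<dots> = T ^ (q - 1) * ?p (q - 1) + (\<Sum>i<q - 1. T ^ (q - Suc (Suc i)) * ?p (q + i))"
      unfolding sum.lessThan_Suc_shift using r by simp
    also have "(\<Sum>i<q - 1. T ^ (q - Suc (Suc i)) * ?p (q + i))
        = (\<Sum>i<q - 2. T ^ (q - Suc (Suc i)) * ?p (q + i)) + ?p (q + (q - 2))"
      using r by simp
    also have "(\<Sum>i<q - 2. T ^ (q - Suc (Suc i)) * ?p (q + i)) = 0"
      by (intro sum.neutral ballI) (simp add: p_mid)
    finally show ?thesis
      unfolding p_a p_one by simp
  qed
  finally show ?thesis
    by (simp add: algebra_simps)
qed

section \<open>Lifting from the prime field\<close>

text \<open>Integer representatives add and multiply up to multiples of \<open>CARD('p)\<close>,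
  which vanish in a field of that characteristic.\<close>

lemma of_prime_field_hom:
  assumes "CHAR('a::field) = CARD('p::prime_card)"
  shows "field_hom (of_prime_field :: 'p mod_ring \<Rightarrow> 'a)"
proof
  have card: "CARD('p) = CHAR('a)"
    using assms by simp
  fix x y :: "'p mod_ring"
  show "of_prime_field (x + y) = (of_prime_field x + of_prime_field y :: 'a)"
    by (simp add: of_prime_field_def to_int_mod_ring_add card)
  show "of_prime_field (x * y) = (of_prime_field x * of_prime_field y :: 'a)"
    by (simp add: of_prime_field_def to_int_mod_ring_mult card)
qed (simp_all add: of_prime_field_def)

context
  assumes char: "CHAR('a::field) = CARD('p::prime_card)"
begin

interpretation field_hom "of_prime_field :: 'p mod_ring \<Rightarrow> 'a"
  by (rule of_prime_field_hom[OF char])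

interpretation map_poly_inj_idom_hom "of_prime_field :: 'p mod_ring \<Rightarrow> 'a" ..

lemma lift_poly_add: "lift_poly (f + g :: 'p mod_ring poly) = (lift_poly f + lift_poly g :: 'a poly)"
  and lift_poly_mult: "lift_poly (f * g :: 'p mod_ring poly) = (lift_poly f * lift_poly g :: 'a poly)"
  and lift_poly_power: "lift_poly (f ^ m :: 'p mod_ring poly) = (lift_poly f ^ m :: 'a poly)"
  and lift_poly_1: "lift_poly (1 :: 'p mod_ring poly) = (1 :: 'a poly)"
  and lift_poly_monom: "lift_poly (monom 1 m :: 'p mod_ring poly) = (monom 1 m :: 'a poly)"
  and lift_poly_eq_iff: "(lift_poly f :: 'a poly) = lift_poly g \<longleftrightarrow> f = g"
  by (simp_all add: lift_poly_def hom_distribs map_poly_monom)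

lemma lift_poly_S_poly: "lift_poly (S_poly Q b :: 'p mod_ring poly) = (S_poly Q b :: 'a poly)"
  unfolding S_poly_def using lift_poly_monom by (simp add: lift_poly_def hom_distribs)

end

text \<open>Generic in the ring because it is read over three fields: the prime field for the
  coefficients, \<open>'f\<close> for the defining identity and \<open>'k\<close> for the
  permutation property.\<close>

definition g_closed :: "nat \<Rightarrow> nat \<Rightarrow> nat \<Rightarrow> 'a::comm_ring_1 poly" where
  "g_closed q e a =
    monom 1 1 * Tr_poly q e + Tr_poly q e ^ 2 + S_poly q a ^ 2 * (1 + Tr_poly q e ^ (q - 1))"

lemma lift_poly_g_closed:
  assumes "CHAR('a::field) = CARD('p::prime_card)"
  shows "lift_poly (g_closed q e a :: 'p mod_ring poly) = (g_closed q e a :: 'a poly)"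
  unfolding g_closed_def
  by (simp only: lift_poly_add[OF assms] lift_poly_mult[OF assms] lift_poly_power[OF assms]
      lift_poly_1[OF assms] lift_poly_monom[OF assms] lift_poly_S_poly[OF assms])

text \<open>The description by \<open>THE\<close> is legitimate: composing with the nonconstant
  \<open>x^q - x\<close> is injective, and so is lifting from the prime field.\<close>

lemma g_poly_eqI:
  assumes "(\<Sum>a\<in>(UNIV :: 'f::finite_field set). (monom 1 1 + [:a:]) ^ n) = lift_poly g \<circ>\<^sub>p Frob_diff"
  shows "g_poly TYPE('f) n = g"
  unfolding g_poly_def
proof (rule the_equality)
  show "(\<Sum>a\<in>(UNIV :: 'f set). (monom 1 1 + [:a:]) ^ n) = lift_poly g \<circ>\<^sub>p Frob_diff"
    by (rule assms)
  fix h :: "'f ring_char mod_ring poly"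
  assume "(\<Sum>a\<in>(UNIV :: 'f set). (monom 1 1 + [:a:]) ^ n) = lift_poly h \<circ>\<^sub>p Frob_diff"
  then have "(lift_poly h - lift_poly g) \<circ>\<^sub>p (Frob_diff :: 'f poly) = 0"
    using assms by (simp add: pcompose_diff)
  moreover have "degree (Frob_diff :: 'f poly) > 0"
  proof -
    have "CARD('f) > 1"
      using card_mono[of UNIV "{0, 1 :: 'f}"] by simp
    then have "coeff (Frob_diff :: 'f poly) CARD('f) \<noteq> 0"
      by simp
    then show ?thesis
      using le_degree[of "Frob_diff :: 'f poly" "CARD('f)"] \<open>CARD('f) > 1\<close> by simp
  qed
  ultimately have "lift_poly h = (lift_poly g :: 'f poly)"
    by (simp add: pcompose_eq_0_iff)
  then show "h = g"
    by (subst (asm) lift_poly_eq_iff) auto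
qed

lemma g_poly_eq_g_closed:
  assumes s: "s > 1" and q: "q = 2 ^ s" "CARD('f::finite_field) = q"
    and n: "n = (q - 1) * q ^ 0 + (q - 1) * q ^ e + 2 * q ^ a"
  shows "g_poly TYPE('f) n = g_closed q e a"
proof (rule g_poly_eqI)
  have card: "CARD('f) = CHAR('f) ^ s"
    using CHAR_finite_field_eqI[of 2 s, where ?'f = 'f] q by simp
  define T S :: "'f poly" where "T = S_poly q e \<circ>\<^sub>p Frob_diff" and "S = S_poly q a \<circ>\<^sub>p Frob_diff"
  have "(monom 1 1 + [:c:]) ^ n = (monom 1 1 + [:c:]) ^ (q - 1) *
      (monom 1 1 + [:c:] + T) ^ (q - 1) * (monom 1 1 + [:c:] + S) ^ 2" for c :: 'f
  proof -
    have "(monom 1 1 + [:c:]) ^ n = (monom 1 1 + [:c:]) ^ (q - 1) *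
        ((monom 1 1 + [:c:]) ^ (q ^ e)) ^ (q - 1) * ((monom 1 1 + [:c:]) ^ (q ^ a)) ^ 2"
      unfolding n by (simp add: power_add mult.commute flip: power_mult)
    then show ?thesis
      using shifted_linear_power_card_power[OF card, of c] by (simp add: T_def S_def q(2))
  qed
  then have "(\<Sum>c\<in>(UNIV :: 'f set). (monom 1 1 + [:c:]) ^ n)
      = Frob_diff * T + T ^ 2 + S ^ 2 * (1 + T ^ (q - 1))"
    using sum_shifted_products[OF s q, of T S] by simp
  also have "\<dots> = g_closed q e a \<circ>\<^sub>p Frob_diff"
    unfolding g_closed_def T_def S_def
    by (simp add: pcompose_add pcompose_mult pcompose_power pcompose_1 pcompose_monom)
  finally show "(\<Sum>c\<in>(UNIV :: 'f set). (monom 1 1 + [:c:]) ^ n)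
      = lift_poly (g_closed q e a :: 'f ring_char mod_ring poly) \<circ>\<^sub>p Frob_diff"
    by (subst lift_poly_g_closed) auto
qed

section \<open>The permutation property\<close>

lemma poly_S_poly: "poly (S_poly q m) x = (\<Sum>i<m. x ^ (q ^ i))"
  by (simp add: S_poly_def poly_sum poly_monom)

section \<open>The maps S_m as sums 1 + F + ... + F^(m-1) of powers of the q-Frobenius F\<close>

context
  fixes q s :: nat
  assumes q: "q = CHAR('a::idom_prime_char) ^ s"
begin

lemma add_power_frob: "(x + y :: 'a) ^ (q ^ i) = x ^ (q ^ i) + y ^ (q ^ i)"
  by (rule freshmans_dream'[of _ "s * i"]) (auto simp: q power_mult)

lemma sum_power_frob: "(\<Sum>j\<in>A. f j :: 'a) ^ (q ^ i) = (\<Sum>j\<in>A. f j ^ (q ^ i))"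
  by (rule freshmans_dream_sum'[of _ "s * i"]) (auto simp: q power_mult)

lemma S_poly_add_arg: "poly (S_poly q m) (x + y :: 'a) = poly (S_poly q m) x + poly (S_poly q m) y"
  by (simp add: poly_S_poly add_power_frob sum.distrib)

lemma S_poly_CHAR_power: "poly (S_poly q m) (x ^ CHAR('a) :: 'a) = poly (S_poly q m) x ^ CHAR('a)"
  unfolding poly_S_poly
  by (subst freshmans_dream_sum) (auto simp: mult.commute simp flip: power_mult)

lemma S_poly_commute:
  "poly (S_poly q m) (poly (S_poly q k) (x :: 'a)) = poly (S_poly q k) (poly (S_poly q m) x)"
  unfolding poly_S_poly sum_power_frob
  by (subst sum.swap) (simp add: mult.commute flip: power_mult)

lemma S_poly_add_index:
  "poly (S_poly q (m + k)) (x :: 'a) = poly (S_poly q m) x ^ (q ^ k) + poly (S_poly q k) x"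
proof -
  have "(\<Sum>i<m + k. x ^ (q ^ i)) = (\<Sum>i<k. x ^ (q ^ i)) + (\<Sum>i<m. x ^ (q ^ (i + k)))"
    by (induction m) (simp_all add: add_ac)
  then show ?thesis
    by (simp add: poly_S_poly sum_power_frob add.commute power_add flip: power_mult)
qed

lemma S_poly_mult_eq_0:
  assumes "poly (S_poly q m) x = (0 :: 'a)"
  shows "poly (S_poly q (m * k)) x = 0"
proof (induction k)
  case (Suc k)
  then show ?case
    using S_poly_add_index[of "m * k" m x] assms by (simp add: q add.commute)
qed (simp add: poly_S_poly)

text \<open>By Bezout \<open>e * l + 1 = a * k\<close>. The root \<open>x\<close> is also a root of
  \<open>S_(el)\<close> and \<open>S_(ak)\<close>, so \<open>S_(el+1)\<close> sends \<open>x\<close>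
  both to \<open>x\<close> and to 0.\<close>

lemma S_poly_coprime_kernel:
  assumes "poly (S_poly q a) x = (0 :: 'a)" "poly (S_poly q e) x = 0" "coprime a e" "a > 0"
  shows "x = 0"
proof -
  obtain k l where "a * k = e * l + gcd a e"
    using bezout_nat[of a e] assms by auto
  then have kl: "e * l + 1 = a * k"
    using assms by simp
  have "poly (S_poly q (e * l + 1)) x = x"
    unfolding S_poly_add_index S_poly_mult_eq_0[OF assms(2)] by (simp add: poly_S_poly q)
  then show ?thesis
    unfolding kl using S_poly_mult_eq_0[OF assms(1)] by simp
qed

lemma power_frob_fixed:
  assumes "c ^ q = (c :: 'a)"
  shows "c ^ (q ^ i) = c"
  by (induction i) (simp_all add: assms power_mult)

lemma S_poly_mult_fixed:
  assumes "c ^ q = (c :: 'a)"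
  shows "poly (S_poly q m) (x * c) = poly (S_poly q m) x * c"
  by (simp add: poly_S_poly power_mult_distrib power_frob_fixed[OF assms] sum_distrib_right)

lemma S_poly_fixed:
  assumes "c ^ q = (c :: 'a)"
  shows "poly (S_poly q m) c = of_nat m * c"
  by (simp add: poly_S_poly power_frob_fixed[OF assms])

end

lemma permutation_poly_g_closed:
  assumes s: "s > 1" and q: "q = 2 ^ s" and card: "CARD('k::finite_field) = q ^ e"
    and even: "even e" and coprime: "coprime a e"
  shows "permutation_poly (g_closed q e a :: 'k poly)"
proof -
  have char: "CHAR('k) = 2"
    by (rule CHAR_finite_field_eqI[of _ "s * e"]) (use q card in \<open>auto simp: power_mult\<close>)
  have frob: "q = CHAR('k) ^ s"
    using q char by simp
  have two: "(2 :: 'k) = 0"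
    using of_nat_CHAR[where ?'a = 'k] char by simp
  have self_add: "x + x = 0" for x :: 'k
    using two by (metis mult_2 mult_zero_left)
  have minus: "- x = x" for x :: 'k
    using self_add by (metis add_eq_0_iff)
  have even_0: "of_nat m = (0 :: 'k)" if "even m" for m
    using that char by (simp add: of_nat_eq_0_iff_char_dvd)
  have "odd a"
    using coprime even by (meson coprime_common_divisor_nat odd_one coprime_def)
  then have "a > 0"
    by (rule odd_pos)
  define Tr where "Tr = poly (S_poly q e :: 'k poly)"
  define S where "S = poly (S_poly q a :: 'k poly)"
  define g where "g = poly (g_closed q e a :: 'k poly)"
  have g: "g x = x * Tr x + Tr x ^ 2 + S x ^ 2 * (1 + Tr x ^ (q - 1))" for x
    by (simp add: g_def g_closed_def Tr_def S_def poly_monom)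
  have sq_inj: "x = y" if "x ^ 2 = y ^ 2" for x y :: 'k
    using that minus by (metis power2_eq_iff)
  have Tr_add: "Tr (x + y) = Tr x + Tr y" and S_add: "S (x + y) = S x + S y" for x y
    by (simp_all add: Tr_def S_def S_poly_add_arg[OF frob])
  have Tr_sq: "Tr (x ^ 2) = Tr x ^ 2" for x
    using S_poly_CHAR_power[OF frob, of e x] char by (simp add: Tr_def)
  have Tr_fixed: "Tr x ^ q = Tr x" for x
  proof -
    have "x ^ (q ^ e) = x"
      by (rule finite_field_power_card_power_eq_same[of _ 1]) (simp add: card)
    \<comment> \<open>Both sides are \<open>S_(e+1)\<close> at \<open>x\<close>, split once as
      \<open>e + 1\<close> and once as \<open>1 + e\<close>.\<close>
    moreover have "Tr x ^ q + x = Tr x + x ^ (q ^ e)"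
      using S_poly_add_index[OF frob, of e 1 x] S_poly_add_index[OF frob, of 1 e x]
      by (simp add: Tr_def poly_S_poly add.commute)
    ultimately show ?thesis
      by simp
  qed
  have g_nonzero: "g x = x * Tr x + Tr x ^ 2" if "Tr x \<noteq> 0" for x
  proof -
    \<comment> \<open>A nonzero trace has (q-1)-th power 1, so the factor
      \<open>1 + Tr x ^ (q - 1)\<close> is 0 and the \<open>S\<close> term drops out.\<close>
    have "Tr x * Tr x ^ (q - 1) = Tr x"
      using Tr_fixed[of x] q by (simp flip: power_Suc)
    then have "Tr x ^ (q - 1) = 1"
      using that by simp
    then show ?thesis
      by (simp add: g self_add two)
  qed
  have "q > 1"
    unfolding q using s by (intro one_less_power) auto
  then have g_zero: "g x = S x ^ 2" if "Tr x = 0" for x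
    using that by (simp add: g)
  have Tr_g: "Tr (g x) = Tr x ^ 2" for x
  proof (cases "Tr x = 0")
    case True
    have "Tr (S x) = S (Tr x)"
      unfolding Tr_def S_def by (rule S_poly_commute[OF frob])
    also have "\<dots> = 0"
      using True q by (simp add: S_def poly_S_poly power_0_left)
    finally show ?thesis
      using True by (simp add: g_zero Tr_sq)
  next
    case False
    have "Tr (x * Tr x) = Tr x ^ 2"
      using S_poly_mult_fixed[OF frob Tr_fixed, of e x x] by (simp add: Tr_def power2_eq_square)
    \<comment> \<open>On elements fixed by Frobenius the trace is multiplication by
      \<open>e\<close>, which is even. Thus \<open>Tr x ^ 2\<close> contributes nothing to the trace
      of \<open>g x\<close>.\<close>
    moreover have "Tr (Tr x) = 0"
      using S_poly_fixed[OF frob Tr_fixed, of e x] even_0[OF even] by (simp add: Tr_def)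
    ultimately show ?thesis
      using False by (simp add: g_nonzero Tr_add Tr_sq)
  qed
  have "inj g"
  proof (rule injI)
    fix x y
    assume eq: "g x = g y"
    then have Tr_eq: "Tr x = Tr y"
      using Tr_g[of x] Tr_g[of y] sq_inj by simp
    show "x = y"
    proof (cases "Tr x = 0")
      case True
      then have "S x = S y"
        using eq Tr_eq g_zero sq_inj by simp
      \<comment> \<open>In characteristic 2, \<open>x + y\<close> is the difference, a common root
        of \<open>S\<close> and \<open>Tr\<close>.\<close>
      then have "S (x + y) = 0" "Tr (x + y) = 0"
        using Tr_eq by (simp_all add: S_add Tr_add self_add)
      then have "x + y = 0"
        using S_poly_coprime_kernel[OF frob _ _ coprime \<open>a > 0\<close>] by (simp add: S_def Tr_def)
      then show ?thesis
        using minus[of y] by (simp add: add_eq_0_iff2)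
    next
      case False
      then show ?thesis
        using eq Tr_eq by (simp add: g_nonzero)
    qed
  qed
  then show ?thesis
    unfolding permutation_poly_def g_def by (simp add: bij_def finite_UNIV_inj_surj)
qed

theorem theorem6p6:
  fixes s e a q n :: nat
  assumes "s > 1" and "e > 0"
    and "q = 2 ^ s"
    and "CARD('f::finite_field) = q"
    and "n = (q - 1) * q ^ 0 + (q - 1) * q ^ e + 2 * q ^ a"
  shows "[g_poly TYPE('f) n =
           monom 1 1 * Tr_poly q e + Tr_poly q e ^ 2 + S_poly q a ^ 2 * (1 + Tr_poly q e ^ (q - 1))]
           (mod (monom 1 (q ^ e) - monom 1 1)) \<and>
         (CARD('k::finite_field) = q ^ e \<longrightarrow> even e \<longrightarrow> gcd a e = 1 \<longrightarrow>
           permutation_poly (lift_poly (g_poly TYPE('f) n) :: 'k poly))"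
proof (intro conjI impI)
  have g: "g_poly TYPE('f) n = g_closed q e a"
    using assms by (intro g_poly_eq_g_closed[of s])
  then show "[g_poly TYPE('f) n =
      monom 1 1 * Tr_poly q e + Tr_poly q e ^ 2 + S_poly q a ^ 2 * (1 + Tr_poly q e ^ (q - 1))]
      (mod (monom 1 (q ^ e) - monom 1 1))"
    by (simp add: g_closed_def)
  assume k: "CARD('k) = q ^ e" "even e" "gcd a e = 1"
  have "CHAR('k) = 2"
    by (rule CHAR_finite_field_eqI[of _ "s * e"]) (use assms k in \<open>auto simp: power_mult\<close>)
  moreover have "CHAR('f) = 2"
    by (rule CHAR_finite_field_eqI[of _ s]) (use assms in auto)
  \<comment> \<open>Equal characteristics make lifting to \<open>'k\<close> a ring homomorphism, so
    it commutes with forming the closed formula.\<close>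
  ultimately have "CHAR('k) = CARD('f ring_char)"
    by simp
  then have "lift_poly (g_poly TYPE('f) n) = (g_closed q e a :: 'k poly)"
    unfolding g by (rule lift_poly_g_closed)
  moreover have "permutation_poly (g_closed q e a :: 'k poly)"
    using assms k by (intro permutation_poly_g_closed[of s]) (auto simp: coprime_iff_gcd_eq_1)
  ultimately show "permutation_poly (lift_poly (g_poly TYPE('f) n) :: 'k poly)"
    by simp
qed

end
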